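(* Let $f$ be a valid feedback function (so that in particular $\sum_{j\in\mathbb{N}} f(j)^{-1}<+\infty$, and in the two-bin process with feedback function $f$ monopoly by one of the bins has probability $1$). Then for all $0<\alpha<\beta<1/2$ there exists a constant $\gamma>0$, depending only on $\alpha$, $\beta$ and $f$, such that for all large enough $n\in\mathbb{N}$, $$\mathbf{Pr}_{[n,\alpha]}\left(\exists N\geq n:\ \mathsf{HasMoreThan}(\beta,N)\right)\leq e^{-n^{\gamma}}.$$ In particular, with initial conditions $[n,\alpha]$, bin $2$ achieves monopoly with all-but-exponentially-small probability, i.e. with probability at least $1-e^{-n^{\gamma}}$ for all large enough $n$.
   Context: $\mathbb{N}=\{1,2,3,\dots\}$. Two-bin balls-in-bins process with feedback function $f:\mathbb{N}\to(0,+\infty)$: the discrete-time Markov chain $\{(I_1(m),I_2(m))\}_{m\geq 0}$ on $\mathbb{N}^2$ in which at each time $m\ge 1$ exactly one ball is added, to bin $i_m\in\{1,2\}$ (so $I_{i_m}(m)=I_{i_m}(m-1)+1$ and the other coordinate is unchanged), where, conditionally on the past, $i_m=i$ with probability $f(I_i(m-1))/(f(I_1(m-1))+f(I_2(m-1)))$. $\mathbf{Pr}_{u}$ denotes probability when the initial state $(I_1(0),I_2(0))$ is $u\in\mathbb{N}^2$. For $n\in\mathbb{N}$ and $0\le\alpha\le 1$, $[n,\alpha]$ denotes the state $(\lceil\alpha n\rceil, n-\lceil\alpha n\rceil)$. Monopoly by bin $i$ is the event that there exists $M\in\mathbb{N}$ such that $i_m=i$ for all $m\ge M$. $\mathsf{HasMoreThan}(\beta,N)$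 is the event that there are more than $\beta N$ balls in bin $1$ at the moment when there is a total of $N$ balls in both bins. Valid feedback function: an increasing function $f:\mathbb{N}\to(0,+\infty)$ with $f(1)=1$ that can be extended to a $C^1$ function $g:[1,+\infty)\to(0,+\infty)$ such that, with $h(x)= x(\ln g)'(x)$ for $x\ge 1$: (1) $\liminf_{x\to+\infty}h(x)>1$; (2) $\lim_{x\to+\infty}x^{-1/4}h(x)=0$; (3) there exist $C>0$ and $x_0\geq 1$ such that for all $\epsilon\in(0,1)$ and all $x\ge x_0$, $\sup_{x\le t\le x^{1+\epsilon}}\left|\frac{h(t)}{h(x)}-1\right|\le C\epsilon$. *)

theory Defs
  imports "HOL-Probability.Probability"
begin

section \<open>Valid feedback functions\<close>

text \<open>
  A function on the positive integers is a function on \<^typ>\<open>nat\<close> whose value at 0 is irrelevant.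
  ``Increasing'' is read in the weak sense. Derivatives are taken within \<^term>\<open>{1..} :: real set\<close>,
  so they are one-sided at 1; \<open>l\<close> is the derivative of \<open>ln \<circ> g\<close>. The supremum is taken in the
  extended reals, so that it is meaningful without a boundedness side condition. At a point where
  \<open>h x = 0\<close>, division by zero makes the quantity under the supremum equal to 1, so the third
  condition (for all \<open>\<epsilon>\<close>) still rules such points out.
\<close>

definition valid_feedback :: "(nat \<Rightarrow> real) \<Rightarrow> bool" where
  "valid_feedback f \<longleftrightarrow>
     mono_on {1..} f \<and> (\<forall>n\<ge>1. f n > 0) \<and> f 1 = 1 \<and>
     (\<exists>(g :: real \<Rightarrow> real) g' l.
        (\<forall>n\<ge>1. g (real n) = f n) \<and>
        (\<forall>x\<ge>1. g x > 0) \<and>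
        (\<forall>x\<ge>1. (g has_real_derivative g' x) (at x within {1..})) \<and>
        continuous_on {1..} g' \<and>
        (\<forall>x\<ge>1. ((\<lambda>t. ln (g t)) has_real_derivative l x) (at x within {1..})) \<and>
        (let h = (\<lambda>x. x * l x) in
           Liminf at_top (\<lambda>x. ereal (h x)) > 1 \<and>
           ((\<lambda>x. x powr (-1/4) * h x) \<longlongrightarrow> 0) at_top \<and>
           (\<exists>C>0. \<exists>x0\<ge>1. \<forall>\<epsilon>\<in>{0<..<1}. \<forall>x\<ge>x0.
              (SUP t\<in>{x..x powr (1 + \<epsilon>)}. ereal \<bar>h t / h x - 1\<bar>) \<le> ereal (C * \<epsilon>))))"


section \<open>The balls-in-bins process\<close>

definition bins_step :: "(nat \<Rightarrow> real) \<Rightarrow> nat \<times> nat \<Rightarrow> (nat \<times> nat) pmf" where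
  "bins_step f s =
     map_pmf (\<lambda>b. if b then (Suc (fst s), snd s) else (fst s, Suc (snd s)))
       (bernoulli_pmf (f (fst s) / (f (fst s) + f (snd s))))"

definition bins_kernel ::
    "(nat \<Rightarrow> real) \<Rightarrow> nat \<times> nat \<Rightarrow> nat \<Rightarrow> (nat \<Rightarrow> nat \<times> nat) \<Rightarrow> (nat \<times> nat) measure" where
  "bins_kernel f u m \<omega> = measure_pmf (if m = 0 then return_pmf u else bins_step f (\<omega> (m - 1)))"

text \<open>
  The law of the chain started at \<open>u\<close>, as a measure on paths \<open>\<omega> :: nat \<Rightarrow> nat \<times> nat\<close> with
  \<open>\<omega> m = (I\<^sub>1(m), I\<^sub>2(m))\<close>. It is the measure with transition kernels \<^const>\<open>bins_kernel\<close> given by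
  the Ionescu-Tulcea theorem; see \<open>bins_process_cylinder\<close> below for its values on cylinders.
\<close>

definition bins_process :: "(nat \<Rightarrow> real) \<Rightarrow> nat \<times> nat \<Rightarrow> (nat \<Rightarrow> nat \<times> nat) measure" where
  "bins_process f u =
     projective_family.lim UNIV
       (Ionescu_Tulcea.CI (bins_kernel f u) (\<lambda>_. count_space UNIV)) (\<lambda>_. count_space UNIV)"

definition initial_state :: "nat \<Rightarrow> real \<Rightarrow> nat \<times> nat" where
  "initial_state n \<alpha> = (nat \<lceil>\<alpha> * real n\<rceil>, n - nat \<lceil>\<alpha> * real n\<rceil>)"

text \<open>\<open>load i \<omega> m\<close> is the number \<open>I\<^sub>i(m)\<close> of balls in bin \<open>i \<in> {1, 2}\<close> at time \<open>m\<close>.\<close>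

definition load :: "nat \<Rightarrow> (nat \<Rightarrow> nat \<times> nat) \<Rightarrow> nat \<Rightarrow> nat" where
  "load i \<omega> m = (if i = 1 then fst (\<omega> m) else snd (\<omega> m))"

text \<open>The ball added at time \<open>m \<ge> 1\<close> goes to bin \<open>i\<close> iff \<open>I\<^sub>i(m) = I\<^sub>i(m - 1) + 1\<close>.\<close>

definition monopoly :: "nat \<Rightarrow> (nat \<Rightarrow> nat \<times> nat) \<Rightarrow> bool" where
  "monopoly i \<omega> \<longleftrightarrow> (\<exists>M\<ge>1. \<forall>m\<ge>M. load i \<omega> m = load i \<omega> (m - 1) + 1)"

definition has_more_than :: "real \<Rightarrow> nat \<Rightarrow> (nat \<Rightarrow> nat \<times> nat) \<Rightarrow> bool" where
  "has_more_than \<beta> N \<omega> \<longleftrightarrow>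
     (\<exists>m. load 1 \<omega> m + load 2 \<omega> m = N \<and> real (load 1 \<omega> m) > \<beta> * real N)"


section \<open>Basic properties of the process\<close>

lemma Ionescu_Tulcea_bins_kernel: "Ionescu_Tulcea (bins_kernel f u) (\<lambda>_. count_space UNIV)"
  unfolding Ionescu_Tulcea_def
proof (intro conjI allI impI)
  fix i
  show "bins_kernel f u i \<in> Pi\<^sub>M {0..<i} (\<lambda>_. count_space UNIV) \<rightarrow>\<^sub>M subprob_algebra (count_space UNIV)"
  proof (cases "i = 0")
    case True
    show ?thesis
      by (simp add: True bins_kernel_def[abs_def] space_subprob_algebra measure_pmf.subprob_space_axioms)
  next
    case False
    have "(\<lambda>\<omega>. \<omega> (i - 1)) \<in> Pi\<^sub>M {0..<i} (\<lambda>_. count_space UNIV) \<rightarrow>\<^sub>M count_space (UNIV :: (nat \<times> nat) set)"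
      using False by (intro measurable_component_singleton) auto
    moreover have "(\<lambda>s. measure_pmf (bins_step f s)) \<in> count_space UNIV \<rightarrow>\<^sub>M subprob_algebra (count_space UNIV)"
      by (simp add: space_subprob_algebra measure_pmf.subprob_space_axioms)
    ultimately have "(\<lambda>\<omega>. measure_pmf (bins_step f (\<omega> (i - 1)))) \<in>
        Pi\<^sub>M {0..<i} (\<lambda>_. count_space UNIV) \<rightarrow>\<^sub>M subprob_algebra (count_space UNIV)"
      by (rule measurable_compose)
    then show ?thesis
      using False by (simp add: bins_kernel_def[abs_def])
  qed
next
  fix i and x :: "nat \<Rightarrow> nat \<times> nat"
  show "prob_space (bins_kernel f u i x)"
    by (simp add: bins_kernel_def measure_pmf.prob_space_axioms)
qed

lemma sets_bins_process: "sets (bins_process f u) = sets (PiM UNIV (\<lambda>_. count_space UNIV))"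
proof -
  interpret Ionescu_Tulcea "bins_kernel f u" "\<lambda>_. count_space UNIV"
    by (rule Ionescu_Tulcea_bins_kernel)
  show ?thesis
    unfolding bins_process_def by simp
qed

lemma space_bins_process: "space (bins_process f u) = UNIV"
  using sets_eq_imp_space_eq[OF sets_bins_process[of f u]] by (simp add: space_PiM PiE_UNIV_domain)

lemma measurable_bins_process [measurable]:
  "(\<lambda>\<omega>. \<omega> m) \<in> bins_process f u \<rightarrow>\<^sub>M count_space UNIV"
  by (subst measurable_cong_sets[OF sets_bins_process refl]) measurable

lemma measurable_load [measurable]:
  "(\<lambda>\<omega>. load i \<omega> m) \<in> bins_process f u \<rightarrow>\<^sub>M count_space UNIV"
  unfolding load_def
  by (rule measurable_compose[OF measurable_bins_process]) simp

lemma pred_monopoly [measurable]: "Measurable.pred (bins_process f u) (monopoly i)"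
  unfolding monopoly_def[abs_def] by measurable

lemma pred_has_more_than [measurable]: "Measurable.pred (bins_process f u) (has_more_than \<beta> N)"
  unfolding has_more_than_def[abs_def] by measurable

lemma prob_space_bins_process: "prob_space (bins_process f u)"
proof
  interpret Ionescu_Tulcea "bins_kernel f u" "\<lambda>_. count_space UNIV"
    by (rule Ionescu_Tulcea_bins_kernel)
  interpret CI: prob_space "CI {}"
    by (rule PF.prob_space_P) auto
  have "emeasure PF.lim (PF.emb UNIV {} (space (CI {}))) = emeasure (CI {}) (space (CI {}))"
    by (rule lim) (auto simp: CI_def)
  moreover have "PF.emb UNIV {} (space (CI {})) = UNIV"
    by (auto simp: CI_def prod_emb_def space_PiM PiE_UNIV_domain)
  ultimately show "emeasure (bins_process f u) (space (bins_process f u)) = 1"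
    unfolding space_bins_process by (simp add: CI.emeasure_space_1 bins_process_def)
qed

lemma bins_process_cylinder:
  "measure (bins_process f u) {\<omega>. \<forall>k\<le>m. \<omega> k = x k} =
     (if x 0 = u then \<Prod>k<m. pmf (bins_step f (x k)) (x (Suc k)) else 0)"
proof -
  interpret Ionescu_Tulcea "bins_kernel f u" "\<lambda>_. count_space UNIV"
    by (rule Ionescu_Tulcea_bins_kernel)
  define B where "B n = PiE {0..<n} (\<lambda>k. {x k})" for n
  define q where "q k = pmf (if k = 0 then return_pmf u else bins_step f (x (k - 1))) (x k)" for k
  have B_sets: "B n \<in> sets (PiM {0..<n} (\<lambda>_. count_space UNIV))" for n
    unfolding B_def by (rule sets_PiM_I_finite) auto
  have C_B: "emeasure (C 0 n (\<lambda>_. undefined)) (B n) = (\<Prod>k<n. ennreal (q k))" for n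
  proof (induction n)
    case 0
    show ?case
      by (simp add: B_def PiM_empty)
  next
    case (Suc n)
    have eP_B: "emeasure (eP n \<omega>) (B (Suc n)) = ennreal (q n) * indicator (B n) \<omega>"
      if \<omega>: "\<omega> \<in> space (PiM {0..<n} (\<lambda>_. count_space UNIV))" for \<omega>
    proof -
      have "emeasure (eP n \<omega>) (B (Suc n)) = emeasure (bins_kernel f u n \<omega>) {y. fun_upd \<omega> n y \<in> B (Suc n)}"
        using emeasure_eP[OF \<omega> B_sets] by (simp add: vimage_def)
      also have "{y. fun_upd \<omega> n y \<in> B (Suc n)} = (if \<omega> \<in> B n then {x n} else {})"
        using \<omega> by (auto simp: B_def PiE_iff space_PiM extensional_def less_Suc_eq)
      also have "emeasure (bins_kernel f u n \<omega>) \<dots> = ennreal (q n) * indicator (B n) \<omega>"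
        by (auto simp: bins_kernel_def q_def emeasure_pmf_single B_def PiE_iff)
      finally show ?thesis .
    qed
    have space: "space (C 0 n (\<lambda>_. undefined)) = space (PiM {0..<n} (\<lambda>_. count_space UNIV))"
      using space_C[of "\<lambda>_. undefined" 0 n] by simp
    have "emeasure (C 0 (Suc n) (\<lambda>_. undefined)) (B (Suc n)) =
        (\<integral>\<^sup>+\<omega>. emeasure (eP n \<omega>) (B (Suc n)) \<partial>C 0 n (\<lambda>_. undefined))"
      using measurable_eP[of n] B_sets[of "Suc n"]
      by (simp, intro emeasure_bind[where N = "PiM {0..<Suc n} (\<lambda>_. count_space UNIV)"])
        (auto simp: space measurable_cong_sets[OF sets_C[of "\<lambda>_. undefined" 0 n, simplified] refl])
    also have "\<dots> = (\<integral>\<^sup>+\<omega>. ennreal (q n) * indicator (B n) \<omega> \<partial>C 0 n (\<lambda>_. undefined))"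
      by (intro nn_integral_cong eP_B) (simp add: space)
    also have "\<dots> = ennreal (q n) * emeasure (C 0 n (\<lambda>_. undefined)) (B n)"
      by (intro nn_integral_cmult_indicator)
        (use B_sets[of n] sets_C[of "\<lambda>_. undefined" 0 n] in simp)
    finally show ?case
      using Suc.IH by (simp add: mult.commute)
  qed
  have "emeasure PF.lim (PF.emb UNIV {0..<Suc m} (B (Suc m))) = emeasure (CI {0..<Suc m}) (B (Suc m))"
    by (rule lim) (use B_sets in auto)
  also have "\<dots> = emeasure (C 0 (Suc m) (\<lambda>_. undefined)) (PF.emb {0..<Suc m} {0..<Suc m} (B (Suc m)))"
    by (rule emeasure_CI) (use B_sets in auto)
  also have "PF.emb {0..<Suc m} {0..<Suc m} (B (Suc m)) = B (Suc m)"
    by (rule prod_emb_id) (auto simp: B_def PiE_iff)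
  also have "PF.emb UNIV {0..<Suc m} (B (Suc m)) = {\<omega>. \<forall>k\<le>m. \<omega> k = x k}"
    by (auto simp: B_def prod_emb_def PiE_iff PiE_UNIV_domain less_Suc_eq_le)
  finally have "emeasure (bins_process f u) {\<omega>. \<forall>k\<le>m. \<omega> k = x k} = (\<Prod>k<Suc m. ennreal (q k))"
    using C_B[of "Suc m"] by (simp only: bins_process_def)
  also have "\<dots> = ennreal (\<Prod>k<Suc m. q k)"
    by (rule prod_ennreal) (simp add: q_def)
  finally have "measure (bins_process f u) {\<omega>. \<forall>k\<le>m. \<omega> k = x k} = (\<Prod>k<Suc m. q k)"
    by (simp add: measure_def prod_nonneg q_def)
  also have "\<dots> = q 0 * (\<Prod>k<m. q (Suc k))"
    by (rule prod.lessThan_Suc_shift)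
  finally show ?thesis
    by (simp add: q_def pmf_return)
qed

end

theory Submission
  imports Defs "HOL-Real_Asymp.Real_Asymp"
begin

text \<open>
  Condition (1) makes \<open>f x / x powr c\<close> nondecreasing for large \<open>x\<close> and some \<open>c > 1\<close>, so
  \<open>\<Sum> 1 / f j\<close> converges. It also makes \<open>f x / x\<close> nondecreasing, so that, as long as bin 1 has
  at most half of the balls, it receives the next one with probability at most its current share
  \<open>I\<^sub>1 / (I\<^sub>1 + I\<^sub>2)\<close>. The share is then a supermartingale, moving by \<open>O(1 / N)\<close> when there are \<open>N\<close>
  balls, and the exponential moment \<open>exp (l * share + l\<^sup>2 / (8 * N))\<close> shows that, started with
  \<open>n\<close> balls, it rises from \<open>\<alpha>\<close> to \<open>\<beta>\<close> with probability at most \<open>exp (- k * n)\<close> up to a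
  constant factor. Any \<open>\<gamma> < 1\<close> will do.

  Monopoly is almost sure because, for every real \<open>\<theta>\<close>,
  \<open>\<Prod>\<^sub>j\<^sub><\<^sub>x (1 + \<i> \<theta> / f j) \<Prod>\<^sub>j\<^sub><\<^sub>y (1 - \<i> \<theta> / f j)\<close> is a martingale along the chain. Normalised
  by its limit as both \<open>x\<close> and \<open>y\<close> tend to infinity, it is bounded by 1 and tends to 1 wherever
  monopoly fails, whereas for \<open>\<theta> \<rightarrow> \<infinity>\<close> its initial value and its limits on monopoly paths tend to 0.
\<close>

section \<open>Cylinder events and the Markov property of the path measure\<close>

abbreviation path_algebra :: "(nat \<Rightarrow> nat \<times> nat) measure" where
  "path_algebra \<equiv> PiM UNIV (\<lambda>_. count_space UNIV)"

text \<open>These are the events whose probabilities \<open>bins_process_cylinder\<close> gives in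
  closed form, so they serve as a generator of the path algebra.\<close>

definition cylinder :: "nat \<Rightarrow> (nat \<Rightarrow> 'a) \<Rightarrow> (nat \<Rightarrow> 'a) set" where
  "cylinder m x = {\<omega>. \<forall>k\<le>m. \<omega> k = x k}"

lemma cylinder_in_sets [measurable]: "cylinder m x \<in> sets path_algebra"
proof -
  have "{\<omega> \<in> space path_algebra. \<forall>k\<le>m. \<omega> k = x k} \<in> sets path_algebra"
    by measurable
  then show ?thesis by (simp add: cylinder_def space_PiM PiE_UNIV_domain)
qed

text \<open>If two prescribed prefixes are compatible, the longer one implies the shorter; otherwise
  they contradict each other, which is why the empty set is added.\<close>

lemma Int_stable_cylinders:
  "Int_stable (insert {} (range (\<lambda>(m, x). cylinder m (x :: nat \<Rightarrow> 'a))))"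
proof (rule Int_stableI)
  have *: "cylinder m x \<inter> cylinder m' y \<in> insert {} (range (\<lambda>(m, x). cylinder m x))"
    if "m \<le> m'" for m m' and x y :: "nat \<Rightarrow> 'a"
  proof (cases "\<forall>k\<le>m. x k = y k")
    case True
    with that have "cylinder m x \<inter> cylinder m' y = cylinder m' y"
      by (auto simp: cylinder_def)
    then show ?thesis by (auto intro!: image_eqI[of _ _ "(m', y)"])
  next
    case False
    with that have "cylinder m x \<inter> cylinder m' y = {}"
      by (fastforce simp: cylinder_def)
    then show ?thesis by simp
  qed
  fix a b :: "(nat \<Rightarrow> 'a) set"
  assume "a \<in> insert {} (range (\<lambda>(m, x). cylinder m x))"
    and "b \<in> insert {} (range (\<lambda>(m, x). cylinder m x))"
  then consider "a = {}" | "b = {}" | m x m' y where "a = cylinder m x" "b = cylinder m' y"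
    by auto
  then show "a \<inter> b \<in> insert {} (range (\<lambda>(m, x). cylinder m x))"
  proof cases
    case 3
    then show ?thesis
      using *[of m m' x y] *[of m' m y x] by (cases "m \<le> m'") (auto simp: Int_commute)
  qed auto
qed

text \<open>The state space is countable, so there are only countably many prefixes up to a given
  time, and an event about one coordinate is a countable union of cylinders.\<close>

lemma sets_path_algebra_eq_cylinders:
  "sets path_algebra = sigma_sets UNIV (insert {} (range (\<lambda>(m, x). cylinder m x)))"
    (is "_ = sigma_sets UNIV ?E")
proof -
  have "sets path_algebra = sigma_sets UNIV {{\<omega>. \<omega> i \<in> B} | i B. True}"
    by (simp add: sets_PiM_single PiE_UNIV_domain)
  also have "\<dots> = sigma_sets UNIV ?E"
  proof (rule sigma_sets_eqI)
    interpret S: sigma_algebra UNIV "sigma_sets UNIV ?E"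
      by (rule sigma_algebra_sigma_sets) auto
    fix a :: "(nat \<Rightarrow> nat \<times> nat) set"
    assume "a \<in> {{\<omega>. \<omega> i \<in> B} | i B. True}"
    then obtain i B where a: "a = {\<omega>. \<omega> i \<in> B}" by blast
    \<comment> \<open>Prefixes are encoded as lists to get a countable index type. For a list that
      is too short, \<open>l ! k\<close> is still some fixed state, so the inclusion from right to
      left is unaffected.\<close>
    have "a = (\<Union>l\<in>{l. l ! i \<in> B}. cylinder i (\<lambda>k. l ! k))"
    proof (intro equalityI subsetI)
      fix \<omega> assume "\<omega> \<in> a"
      then show "\<omega> \<in> (\<Union>l\<in>{l. l ! i \<in> B}. cylinder i (\<lambda>k. l ! k))"
        by (intro UN_I[of "map \<omega> [0..<Suc i]"])
          (auto simp: a cylinder_def nth_append less_Suc_eq_le simp del: upt_Suc)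
    qed (auto simp: a cylinder_def)
    moreover have "cylinder i (\<lambda>k. l ! k) \<in> sigma_sets UNIV ?E" for l
      by (intro sigma_sets.Basic) (auto intro!: image_eqI[of _ _ "(i, \<lambda>k. l ! k)"])
    ultimately show "a \<in> sigma_sets UNIV ?E"
      by (simp only:) (rule S.countable_UN', auto)
  next
    fix b assume "b \<in> ?E"
    then have "b \<in> sets path_algebra" by auto
    then show "b \<in> sigma_sets UNIV {{\<omega>. \<omega> i \<in> B} | i B. True}"
      by (simp add: sets_PiM_single PiE_UNIV_domain)
  qed
  finally show ?thesis .
qed

lemma measurable_case_nat_path [measurable]: "case_nat u \<in> path_algebra \<rightarrow>\<^sub>M path_algebra"
proof (rule measurable_PiM_single')
  fix i
  show "(\<lambda>\<omega>. case_nat u \<omega> i) \<in> path_algebra \<rightarrow>\<^sub>M count_space UNIV"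
    by (cases i) auto
qed auto

lemma measurable_case_nat_bins_process [measurable]:
  "case_nat u \<in> bins_process f s \<rightarrow>\<^sub>M path_algebra"
  by (simp add: measurable_cong_sets[OF sets_bins_process refl])

lemma measurable_first_step:
  "(\<lambda>s. distr (bins_process f s) path_algebra (case_nat u))
    \<in> measure_pmf (bins_step f u) \<rightarrow>\<^sub>M subprob_algebra path_algebra"
  by (auto simp: measurable_pmf_measure1 space_subprob_algebra intro!: prob_space_imp_subprob_space
      prob_space.prob_space_distr prob_space_bins_process)

text \<open>Finite measures that agree on an intersection-stable generator coincide, and the
  cylinder formula factors off its first transition. The result turns the Ionescu-Tulcea measure
  into a recursion on the initial state, which drives all later inductions over time.\<close>

lemma bins_process_first_step:
  "bins_process f u = measure_pmf (bins_step f u) \<bind>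
     (\<lambda>s. distr (bins_process f s) path_algebra (case_nat u))"
    (is "_ = ?R")
proof -
  have sets_R: "sets ?R = sets path_algebra"
    by (rule sets_bind[OF subprob_measurableD(2)[OF measurable_first_step]]) auto
  have R: "emeasure ?R E = (\<integral>\<^sup>+s. emeasure (bins_process f s) (case_nat u -` E) \<partial>bins_step f u)"
    if "E \<in> sets path_algebra" for E
    using that by (simp add: emeasure_bind[OF _ measurable_first_step] emeasure_distr space_bins_process)
  show ?thesis
  proof (rule measure_eqI_generator_eq_countable[OF Int_stable_cylinders])
    show "sets (bins_process f u) = sigma_sets UNIV (insert {} (range (\<lambda>(m, x). cylinder m x)))"
      unfolding sets_bins_process sets_path_algebra_eq_cylinders ..
    show "sets ?R = sigma_sets UNIV (insert {} (range (\<lambda>(m, x). cylinder m x)))"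
      unfolding sets_R sets_path_algebra_eq_cylinders ..
    \<comment> \<open>Fixing only the state at time 0 gives a countable cover of the path
      space.\<close>
    show "range (\<lambda>s. cylinder 0 (\<lambda>_. s)) \<subseteq> insert {} (range (\<lambda>(m, x). cylinder m x))"
      by auto
    show "\<Union> (range (\<lambda>s. cylinder 0 (\<lambda>_. s))) = UNIV"
      by (auto simp: cylinder_def)
    show "emeasure (bins_process f u) a \<noteq> \<infinity>" for a
      using finite_measure.emeasure_finite[OF prob_space.finite_measure[OF prob_space_bins_process]]
      by auto
  next
    fix E :: "(nat \<Rightarrow> nat \<times> nat) set"
    assume "E \<in> insert {} (range (\<lambda>(m, x). cylinder m x))"
    then consider "E = {}" | m x where "E = cylinder m x" by auto
    then show "emeasure (bins_process f u) E = emeasure ?R E"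
    proof cases
      case 2
      have em: "emeasure (bins_process f s) (cylinder m x) =
          ennreal (if x 0 = s then \<Prod>k<m. pmf (bins_step f (x k)) (x (Suc k)) else 0)" for s m x
        unfolding bins_process_cylinder[symmetric] cylinder_def
        by (rule finite_measure.emeasure_eq_measure)
          (rule prob_space.finite_measure[OF prob_space_bins_process])
      show ?thesis
      proof (cases m)
        case 0
        have *: "case_nat u -` cylinder 0 x = (if x 0 = u then UNIV else {})"
          by (auto simp: cylinder_def)
        have "emeasure (bins_process f s) UNIV = 1" for s
          using prob_space.emeasure_space_1[OF prob_space_bins_process, of f s]
          by (simp add: space_bins_process)
        then show ?thesis
          using 0 by (simp add: 2 R em *)
      next
        case (Suc m')
        have *: "case_nat u -` cylinder (Suc m') x = (if x 0 = u then cylinder m' (\<lambda>k. x (Suc k)) else {})"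
          by (auto simp: cylinder_def All_less_Suc2 simp del: All_less_Suc simp flip: less_Suc_eq_le)
        \<comment> \<open>Only the chain restarted at \<open>x (Suc 0)\<close> charges the shifted
          cylinder, so integrating over the first step leaves a single transition
          probability.\<close>
        have "(\<integral>\<^sup>+s. emeasure (bins_process f s) (cylinder m' (\<lambda>k. x (Suc k))) \<partial>bins_step f u) =
          (\<integral>\<^sup>+s. ennreal (\<Prod>k<m'. pmf (bins_step f (x (Suc k))) (x (Suc (Suc k)))) *
             indicator {x (Suc 0)} s \<partial>bins_step f u)"
          by (intro nn_integral_cong) (auto simp: em indicator_def)
        also have "\<dots> = ennreal (\<Prod>k<m'. pmf (bins_step f (x (Suc k))) (x (Suc (Suc k)))) *
             ennreal (pmf (bins_step f u) (x (Suc 0)))"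
          by (simp add: nn_integral_cmult emeasure_pmf_single)
        finally show ?thesis
          by (simp add: 2 R * em Suc prod.lessThan_Suc_shift ennreal_mult'' prod_nonneg mult.commute
              del: prod.lessThan_Suc)
      qed
    qed simp
  qed auto
qed

lemma emeasure_bins_process_first_step:
  assumes "E \<in> sets path_algebra"
  shows "emeasure (bins_process f u) E =
    (\<integral>\<^sup>+s. emeasure (bins_process f s) (case_nat u -` E) \<partial>bins_step f u)"
  using assms
  by (subst bins_process_first_step)
    (simp add: emeasure_bind[OF _ measurable_first_step] emeasure_distr space_bins_process)

lemma AE_bins_process_first_step:
  assumes "Measurable.pred path_algebra Q"
    and "\<And>s. s \<in> set_pmf (bins_step f u) \<Longrightarrow> AE \<omega> in bins_process f s. Q (case_nat u \<omega>)"
  shows "AE \<omega> in bins_process f u. Q \<omega>"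
  using assms
  by (subst bins_process_first_step)
    (simp add: AE_bind[OF measurable_first_step] AE_measure_pmf_iff AE_distr_iff)

lemma AE_bins_process_0: "AE \<omega> in bins_process f u. \<omega> 0 = u"
  by (rule AE_bins_process_first_step) auto

lemma set_bins_step: "set_pmf (bins_step f s) \<subseteq> {(Suc (fst s), snd s), (fst s, Suc (snd s))}"
  by (auto simp: bins_step_def)

lemma AE_bins_process_step:
  "AE \<omega> in bins_process f u. \<omega> (Suc m) \<in> {(Suc (fst (\<omega> m)), snd (\<omega> m)), (fst (\<omega> m), Suc (snd (\<omega> m)))}"
proof (induction m arbitrary: u)
  case 0
  show ?case
  proof (rule AE_bins_process_first_step)
    fix s assume "s \<in> set_pmf (bins_step f u)"
    then have "s \<in> {(Suc (fst u), snd u), (fst u, Suc (snd u))}"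
      using set_bins_step by blast
    with AE_bins_process_0[of s f]
    show "AE \<omega> in bins_process f s. case_nat u \<omega> (Suc 0)
        \<in> {(Suc (fst (case_nat u \<omega> 0)), snd (case_nat u \<omega> 0)), (fst (case_nat u \<omega> 0), Suc (snd (case_nat u \<omega> 0)))}"
      by (auto elim!: eventually_mono)
  qed measurable
next
  case (Suc m)
  show ?case
    by (rule AE_bins_process_first_step) (use Suc in \<open>auto\<close>)
qed

text \<open>The recursion peels off the first transition rather than the last, to match
  \<open>bins_process_first_step\<close>. Every marginal has finite support, so its expectations are
  finite sums.\<close>

fun bins_marginal :: "(nat \<Rightarrow> real) \<Rightarrow> nat \<times> nat \<Rightarrow> nat \<Rightarrow> (nat \<times> nat) pmf" where
  "bins_marginal f u 0 = return_pmf u"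
| "bins_marginal f u (Suc m) = bind_pmf (bins_step f u) (\<lambda>s. bins_marginal f s m)"

lemma distr_bins_process: "distr (bins_process f u) (count_space UNIV) (\<lambda>\<omega>. \<omega> m) = bins_marginal f u m"
proof (rule measure_eqI)
  fix B :: "(nat \<times> nat) set"
  have sets: "{\<omega>. \<omega> m \<in> B} \<in> sets path_algebra" for m
    using measurable_sets[of "\<lambda>\<omega>. \<omega> m" path_algebra "count_space UNIV" B]
    by (simp add: vimage_def space_PiM PiE_UNIV_domain)
  have "emeasure (bins_process f u) {\<omega>. \<omega> m \<in> B} = emeasure (bins_marginal f u m) B"
  proof (induction m arbitrary: u)
    case 0
    show ?case
      by (subst emeasure_bins_process_first_step[OF sets])
        (use prob_space.emeasure_space_1[OF prob_space_bins_process, of f] in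
          \<open>auto simp: space_bins_process indicator_def\<close>)
  next
    case (Suc m)
    then show ?case
      by (subst emeasure_bins_process_first_step[OF sets]) (simp add: vimage_def)
  qed
  then show "emeasure (distr (bins_process f u) (count_space UNIV) (\<lambda>\<omega>. \<omega> m)) B =
      emeasure (bins_marginal f u m) B"
    by (simp add: emeasure_distr space_bins_process vimage_def)
qed simp

section \<open>Hitting probabilities bounded by superharmonic functions\<close>

text \<open>Optional stopping as an induction on the horizon: a start in \<open>B\<close> has
  \<open>V u\<close> at least 1, and from any other start the hit happens after the first step,
  whose average of \<open>V\<close> is at most \<open>V u\<close>. The set \<open>S\<close> is
  closed under steps and confines the hypotheses on \<open>V\<close>.\<close>

lemma hitting_bound_finite:
  fixes V :: "nat \<times> nat \<Rightarrow> ennreal"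
  assumes V: "\<And>s. s \<in> S \<Longrightarrow> s \<in> B \<Longrightarrow> V s \<ge> 1"
    and S: "\<And>s. s \<in> S \<Longrightarrow> set_pmf (bins_step f s) \<subseteq> S"
    and sup: "\<And>s. s \<in> S \<Longrightarrow> s \<notin> B \<Longrightarrow> (\<integral>\<^sup>+t. V t \<partial>bins_step f s) \<le> V s"
  shows "u \<in> S \<Longrightarrow> emeasure (bins_process f u) {\<omega>. \<exists>m\<le>M. \<omega> m \<in> B} \<le> V u"
proof (induction M arbitrary: u)
  interpret P: prob_space "bins_process f u" for u by (rule prob_space_bins_process)
  have sets: "{\<omega>. \<exists>m\<le>M. \<omega> m \<in> B} \<in> sets path_algebra" for M
  proof -
    have "{\<omega> \<in> space path_algebra. \<exists>m\<le>M. \<omega> m \<in> B} \<in> sets path_algebra" by measurable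
    then show ?thesis by (simp add: space_PiM PiE_UNIV_domain)
  qed
  note first_step = emeasure_bins_process_first_step[OF sets]
  have le1: "emeasure (bins_process f u) X \<le> V u" if "u \<in> S" "u \<in> B" for u X
    using V[OF that] P.emeasure_le_1[of u X] by (rule order_trans[rotated])
  {
    case 0
    show ?case
    proof (cases "u \<in> B")
      case False
      then show ?thesis by (subst first_step) simp
    qed (use le1 0 in auto)
  next
    case (Suc M)
    show ?case
    proof (cases "u \<in> B")
      case False
      have "case_nat u -` {\<omega>. \<exists>m\<le>Suc M. \<omega> m \<in> B} = {\<omega>. \<exists>m\<le>M. \<omega> m \<in> B}"
        using False by (auto simp: Ex_less_Suc2 simp del: Ex_less_Suc simp flip: less_Suc_eq_le)
      then have "emeasure (bins_process f u) {\<omega>. \<exists>m\<le>Suc M. \<omega> m \<in> B} =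
          (\<integral>\<^sup>+s. emeasure (bins_process f s) {\<omega>. \<exists>m\<le>M. \<omega> m \<in> B} \<partial>bins_step f u)"
        by (simp add: first_step)
      also have "\<dots> \<le> (\<integral>\<^sup>+s. V s \<partial>bins_step f u)"
        by (intro nn_integral_mono_AE) (use Suc.IH S[OF Suc.prems] in \<open>simp add: AE_measure_pmf_iff subset_eq\<close>)
      also have "\<dots> \<le> V u" using False Suc.prems sup by simp
      finally show ?thesis .
    qed (use le1 Suc.prems in auto)
  }
qed

text \<open>The finite-horizon events increase to the event of ever hitting \<open>B\<close>, and
  the bound \<open>V u\<close> does not depend on the horizon.\<close>

lemma hitting_bound:
  fixes V :: "nat \<times> nat \<Rightarrow> ennreal"
  assumes V: "\<And>s. s \<in> S \<Longrightarrow> s \<in> B \<Longrightarrow> V s \<ge> 1"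
    and S: "\<And>s. s \<in> S \<Longrightarrow> set_pmf (bins_step f s) \<subseteq> S"
    and sup: "\<And>s. s \<in> S \<Longrightarrow> s \<notin> B \<Longrightarrow> (\<integral>\<^sup>+t. V t \<partial>bins_step f s) \<le> V s"
    and u: "u \<in> S"
  shows "emeasure (bins_process f u) {\<omega>. \<exists>m. \<omega> m \<in> B} \<le> V u"
proof -
  have sets: "{\<omega>. \<exists>m\<le>M. \<omega> m \<in> B} \<in> sets (bins_process f u)" for M
  proof -
    have "{\<omega> \<in> space (bins_process f u). \<exists>m\<le>M. \<omega> m \<in> B} \<in> sets (bins_process f u)" by measurable
    then show ?thesis by (simp add: space_bins_process)
  qed
  have "(SUP M. emeasure (bins_process f u) {\<omega>. \<exists>m\<le>M. \<omega> m \<in> B}) =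
      emeasure (bins_process f u) (\<Union>M::nat. {\<omega> :: nat \<Rightarrow> nat \<times> nat. \<exists>m\<le>M. \<omega> m \<in> B})"
    by (rule SUP_emeasure_incseq) (use sets in \<open>auto simp: incseq_def intro: order_trans\<close>)
  also have "(\<Union>M::nat. {\<omega> :: nat \<Rightarrow> nat \<times> nat. \<exists>m\<le>M. \<omega> m \<in> B}) = {\<omega>. \<exists>m. \<omega> m \<in> B}"
  proof (intro equalityI subsetI)
    fix \<omega> :: "nat \<Rightarrow> nat \<times> nat" assume "\<omega> \<in> {\<omega>. \<exists>m. \<omega> m \<in> B}"
    then obtain m where "\<omega> m \<in> B" by auto
    then show "\<omega> \<in> (\<Union>M::nat. {\<omega> :: nat \<Rightarrow> nat \<times> nat. \<exists>m\<le>M. \<omega> m \<in> B})" by (intro UN_I[of m]) auto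
  qed auto
  finally show ?thesis
    using SUP_least[of UNIV "\<lambda>M. emeasure (bins_process f u) {\<omega>. \<exists>m\<le>M. \<omega> m \<in> B}" "V u"]
      hitting_bound_finite[OF V S sup u] by simp
qed

section \<open>Growth of valid feedback functions\<close>

text \<open>For \<open>c\<close> strictly between 1 and the lower limit of \<open>h\<close>, the
  function \<open>ln (g x) - c * ln x\<close> has derivative \<open>(h x - c) / x\<close>, which is
  positive for large \<open>x\<close>.\<close>

lemma valid_feedback_growth:
  assumes "valid_feedback f"
  obtains c :: real and x0 :: nat where "c > 1" "x0 \<ge> 1"
    "\<And>m n. x0 \<le> m \<Longrightarrow> m \<le> n \<Longrightarrow> f m * (real n / real m) powr c \<le> f n"
proof -
  from assms obtain g l where g: "\<And>n. n \<ge> 1 \<Longrightarrow> g (real n) = f n" "\<And>x. x \<ge> 1 \<Longrightarrow> g x > 0"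
    and l: "\<And>x. x \<ge> 1 \<Longrightarrow> ((\<lambda>t. ln (g t)) has_real_derivative l x) (at x within {1..})"
    and lim: "Liminf at_top (\<lambda>x. ereal (x * l x)) > 1"
    unfolding valid_feedback_def Let_def by blast
  from lim obtain c :: real where c: "1 < ereal c" "ereal c < Liminf at_top (\<lambda>x. ereal (x * l x))"
    using ereal_dense2 by blast
  from less_LiminfD[OF c(2)] obtain X where X: "\<And>x. x \<ge> X \<Longrightarrow> c < x * l x"
    by (auto simp: eventually_at_top_linorder)
  \<comment> \<open>The bound 2 keeps the points in the interior of \<open>{1..}\<close>, where the
    one-sided derivative is an ordinary one.\<close>
  define x0 where "x0 = nat \<lceil>max X 2\<rceil>"
  have x0: "real x0 \<ge> X" "real x0 \<ge> 2"
    unfolding x0_def by linarith+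
  show ?thesis
  proof
    show "c > 1" using c(1) by simp
    show "x0 \<ge> 1" using x0(2) by simp
    fix m n assume mn: "x0 \<le> m" "m \<le> n"
    have "ln (g (real m)) - c * ln (real m) \<le> ln (g (real n)) - c * ln (real n)"
    proof (rule DERIV_nonneg_imp_nondecreasing[where f = "\<lambda>x. ln (g x) - c * ln x"])
      fix x assume "real m \<le> x" "x \<le> real n"
      with mn x0 have x: "x \<ge> 2" "x \<ge> X" by auto
      have "at x within {1..} = at x"
        using x by (intro at_within_interior) (simp add: interior_real_atLeast)
      then have d: "((\<lambda>t. ln (g t)) has_real_derivative l x) (at x)"
        using l[of x] x by simp
      have "((\<lambda>t. ln (g t) - c * ln t) has_real_derivative l x - c * (1 / x)) (at x)"
        by (rule DERIV_diff[OF d DERIV_cmult[OF DERIV_ln_divide]]) (use x in auto)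
      moreover have "l x - c * (1 / x) \<ge> 0"
        using X[OF x(2)] x by (simp add: field_simps)
      ultimately show "\<exists>y. ((\<lambda>t. ln (g t) - c * ln t) has_real_derivative y) (at x) \<and> y \<ge> 0"
        by blast
    qed (use mn in auto)
    moreover have pos: "m > 0" "n > 0" "f m > 0" "f n > 0"
      using mn x0 g(1)[of m] g(2)[of "real m"] g(1)[of n] g(2)[of "real n"] by auto
    ultimately have "ln (f m * (real n / real m) powr c) \<le> ln (f n)"
      using g(1)[of m] g(1)[of n] by (simp add: ln_mult ln_powr ln_div algebra_simps)
    then show "f m * (real n / real m) powr c \<le> f n"
      using pos by simp
  qed
qed

lemma valid_feedback_pos: "valid_feedback f \<Longrightarrow> n \<ge> 1 \<Longrightarrow> f n > 0"
  by (auto simp: valid_feedback_def)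

text \<open>Comparison with the series of \<open>n powr (- c)\<close>, which converges because
  \<open>c > 1\<close>.\<close>

lemma valid_feedback_summable:
  assumes "valid_feedback f"
  shows "summable (\<lambda>j. 1 / f (Suc j))"
proof -
  obtain c x0 where c: "c > 1" "x0 \<ge> 1"
    and growth: "\<And>m n. x0 \<le> m \<Longrightarrow> m \<le> n \<Longrightarrow> f m * (real n / real m) powr c \<le> f n"
    using valid_feedback_growth[OF assms] by blast
  have "summable (\<lambda>j. 1 / f j)"
  proof (rule summable_comparison_test_ev)
    show "summable (\<lambda>n. (real x0 powr c / f x0) * real n powr (- c))"
      using c summable_real_powr_iff[of "-c"] by (intro summable_mult) auto
    show "\<forall>\<^sub>F n in sequentially. norm (1 / f n) \<le> (real x0 powr c / f x0) * real n powr (- c)"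
      using eventually_ge_at_top[of x0]
    proof eventually_elim
      case (elim n)
      have pos: "f x0 > 0" "f n > 0" using valid_feedback_pos[OF assms] c elim by auto
      have "f x0 * (real n powr c / real x0 powr c) \<le> f n"
        using growth[of x0 n] elim by (simp add: powr_divide)
      then show ?case
        using pos c elim by (simp add: powr_minus field_simps)
    qed
  qed
  then show ?thesis by (subst summable_Suc_iff)
qed

section \<open>The exponential supermartingale for the share of bin 1\<close>

text \<open>The term \<open>l\<^sup>2 / (8 * n)\<close> is a budget for all future fluctuations: a
  step from \<open>n\<close> balls costs \<open>l\<^sup>2 / (8 * (n + 1)\<^sup>2)\<close> by
  Hoeffding's lemma, and the sum of \<open>1 / k\<^sup>2\<close> over \<open>k > n\<close> is at
  most \<open>1 / n\<close>.\<close>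

lemma exp_potential_step:
  fixes p l \<beta> :: real and x n :: nat
  assumes "l \<ge> 0" "n > 0" "p \<le> real x / real n"
  shows "p * exp (l * (real (Suc x) / real (Suc n) - \<beta>) + l\<^sup>2 / (8 * real (Suc n))) +
      (1 - p) * exp (l * (real x / real (Suc n) - \<beta>) + l\<^sup>2 / (8 * real (Suc n)))
    \<le> exp (l * (real x / real n - \<beta>) + l\<^sup>2 / (8 * real n))"
proof -
  define h where "h = l / real (Suc n)"
  define q where "q = real x / real n"
  define e where "e = exp (l * (real x / real (Suc n) - \<beta>) + l\<^sup>2 / (8 * real (Suc n)))"
  have h: "h \<ge> 0" and q: "q \<ge> 0" using assms by (simp_all add: h_def q_def)
  have "exp (l * (real (Suc x) / real (Suc n) - \<beta>) + l\<^sup>2 / (8 * real (Suc n))) = e * exp h"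
  proof -
    have "real (Suc x) / real (Suc n) = real x / real (Suc n) + 1 / real (Suc n)"
      by (simp add: add_divide_distrib)
    then show ?thesis
      unfolding e_def h_def exp_add[symmetric] by (simp add: algebra_simps del: of_nat_Suc)
  qed
  then have "p * exp (l * (real (Suc x) / real (Suc n) - \<beta>) + l\<^sup>2 / (8 * real (Suc n))) +
      (1 - p) * exp (l * (real x / real (Suc n) - \<beta>) + l\<^sup>2 / (8 * real (Suc n)))
    = e * (1 + p * (exp h - 1))"
    by (simp add: e_def algebra_simps)
  also have "\<dots> \<le> e * (1 + q * (exp h - 1))"
    using assms(3) h by (intro mult_left_mono add_left_mono mult_right_mono) (auto simp: e_def q_def)
  \<comment> \<open>\<open>Hoeffdings_lemma_aux\<close> is the logarithm of this bound on the moment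
    generating function of a Bernoulli variable with mean \<open>q\<close>.\<close>
  also have "1 + q * (exp h - 1) \<le> exp (h * q + h\<^sup>2 / 8)"
  proof -
    have "1 + q * (exp h - 1) > 0" using h q by (intro add_pos_nonneg) auto
    then show ?thesis
      using Hoeffdings_lemma_aux[OF h q] by (subst ln_le_cancel_iff[symmetric]) auto
  qed
  then have "e * (1 + q * (exp h - 1)) \<le> e * exp (h * q + h\<^sup>2 / 8)"
    by (intro mult_left_mono) (auto simp: e_def)
  also have "e * exp (h * q + h\<^sup>2 / 8) \<le> exp (l * (real x / real n - \<beta>) + l\<^sup>2 / (8 * real n))"
  proof -
    \<comment> \<open>The linear terms match exactly: with success probability equal to the share,
      the share is a martingale.\<close>
    have 1: "l * (real x / real (Suc n)) + h * q = l * (real x / real n)"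
      unfolding h_def q_def using assms(2) by (simp add: divide_simps) (simp add: algebra_simps)
    \<comment> \<open>One step of the telescoping bound: \<open>1 / (n + 1)\<^sup>2\<close> is at
      most \<open>1 / n - 1 / (n + 1)\<close>.\<close>
    have 2: "1 / real (Suc n) + 1 / (real (Suc n))\<^sup>2 \<le> 1 / real n"
      using assms(2) by (simp add: divide_simps power2_eq_square) (simp add: algebra_simps)
    have "l\<^sup>2 / (8 * real (Suc n)) + h\<^sup>2 / 8 = l\<^sup>2 / 8 * (1 / real (Suc n) + 1 / (real (Suc n))\<^sup>2)"
      unfolding h_def by (simp add: power_divide algebra_simps)
    also have "\<dots> \<le> l\<^sup>2 / 8 * (1 / real n)"
      using 2 by (intro mult_left_mono) auto
    finally have 3: "l\<^sup>2 / (8 * real (Suc n)) + h\<^sup>2 / 8 \<le> l\<^sup>2 / (8 * real n)" by simp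
    show ?thesis
      unfolding e_def exp_add[symmetric] using 1 3 by (simp add: right_diff_distrib)
  qed
  finally show ?thesis .
qed

lemma nn_integral_bins_step:
  assumes "f (fst s) > 0" "f (snd s) > 0" "\<And>t. V t \<ge> 0"
  shows "(\<integral>\<^sup>+t. ennreal (V t) \<partial>bins_step f s) =
    ennreal (f (fst s) / (f (fst s) + f (snd s)) * V (Suc (fst s), snd s) +
      (1 - f (fst s) / (f (fst s) + f (snd s))) * V (fst s, Suc (snd s)))"
proof -
  define p where "p = f (fst s) / (f (fst s) + f (snd s))"
  have p: "0 \<le> p" "p \<le> 1" using assms by (simp_all add: p_def)
  have "(\<integral>\<^sup>+t. ennreal (V t) \<partial>bins_step f s) =
      ennreal (V (Suc (fst s), snd s)) * ennreal p + ennreal (V (fst s, Suc (snd s))) * ennreal (1 - p)"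
    using p by (simp add: bins_step_def flip: p_def)
  also have "\<dots> = ennreal (p * V (Suc (fst s), snd s) + (1 - p) * V (fst s, Suc (snd s)))"
    using p assms(3) by (simp add: ennreal_mult ennreal_plus mult.commute)
  finally show ?thesis by (simp add: p_def)
qed

text \<open>An application of \<open>hitting_bound\<close> to the potential of
  \<open>exp_potential_step\<close>, whose exponent is nonnegative once the share exceeds \<beta>.
  The set \<open>S\<close> keeps bin 2 nonempty and bin 1 large enough for \<open>growth\<close>; it
  is closed because loads never fall.\<close>

lemma ratio_hitting_bound:
  fixes f :: "nat \<Rightarrow> real" and l \<beta> :: real
  assumes pos: "\<And>n. n \<ge> 1 \<Longrightarrow> f n > 0"
    and growth: "\<And>m n. x0 \<le> m \<Longrightarrow> m \<le> n \<Longrightarrow> f m * (real n / real m) \<le> f n"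
    and x0: "x0 \<ge> 1" and start: "a \<ge> x0" "b \<ge> 1" and "\<beta> \<le> 1 / 2" "l \<ge> 0"
  shows "measure (bins_process f (a, b)) {\<omega>. \<exists>m. real (fst (\<omega> m)) > \<beta> * real (fst (\<omega> m) + snd (\<omega> m))}
    \<le> exp (l * (real a / real (a + b) - \<beta>) + l\<^sup>2 / (8 * real (a + b)))"
proof -
  interpret P: prob_space "bins_process f (a, b)" by (rule prob_space_bins_process)
  define V where "V = (\<lambda>(x, y). exp (l * (real x / real (x + y) - \<beta>) + l\<^sup>2 / (8 * real (x + y))))"
  have V_nonneg: "V t \<ge> 0" for t by (simp add: V_def case_prod_beta)
  define B where "B = {(x, y). real x > \<beta> * real (x + y)}"
  define S where "S = {(x, y). x \<ge> x0 \<and> y \<ge> (1::nat)}"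
  have "emeasure (bins_process f (a, b)) {\<omega>. \<exists>m. \<omega> m \<in> B} \<le> ennreal (V (a, b))"
  proof (rule hitting_bound)
    show "(a, b) \<in> S" using start by (simp add: S_def)
    fix s assume "s \<in> S"
    then obtain x y where s: "s = (x, y)" and xy: "x \<ge> x0" "y \<ge> 1" by (auto simp: S_def)
    show "set_pmf (bins_step f s) \<subseteq> S"
      using set_bins_step[of f s] xy by (auto simp: s S_def)
    show "1 \<le> ennreal (V s)" if "s \<in> B"
    proof -
      have "\<beta> \<le> real x / real (x + y)"
        using that xy by (simp add: B_def s field_simps)
      then have "V s \<ge> exp 0"
        using \<open>l \<ge> 0\<close> unfolding V_def s prod.case by (subst exp_le_cancel_iff) simp
      then show ?thesis by (simp add: ennreal_ge_1)
    qed
    show "(\<integral>\<^sup>+t. ennreal (V t) \<partial>bins_step f s) \<le> ennreal (V s)" if "s \<notin> B"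
    proof -
      \<comment> \<open>Outside \<open>B\<close>, the bound \<beta> \<le> 1/2 puts bin 1 behind or
        level, the direction in which \<open>growth\<close> compares \<open>f x / x\<close> with
        \<open>f y / y\<close>.\<close>
      have "real x \<le> \<beta> * real (x + y)" using that by (simp add: B_def s)
      also have "\<dots> \<le> 1 / 2 * real (x + y)" using \<open>\<beta> \<le> 1 / 2\<close> by (intro mult_right_mono) auto
      finally have "x \<le> y" by simp
      have fpos: "f x > 0" "f y > 0" using pos xy x0 by auto
      have "f x * real y \<le> f y * real x"
        using growth[OF xy(1) \<open>x \<le> y\<close>] xy x0 by (simp add: field_simps)
      then have "f x / (f x + f y) \<le> real x / real (x + y)"
        using fpos xy x0 by (simp add: field_simps)
      then have "f x / (f x + f y) * V (Suc x, y) + (1 - f x / (f x + f y)) * V (x, Suc y) \<le> V (x, y)"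
        using exp_potential_step[of l "x + y" "f x / (f x + f y)" x \<beta>] \<open>l \<ge> 0\<close> xy
        by (simp only: V_def prod.case add_Suc add_Suc_right)
      then show ?thesis
        using fpos unfolding s
        by (subst nn_integral_bins_step) (simp_all only: V_nonneg fst_conv snd_conv ennreal_leI)
    qed
  qed
  then show ?thesis
    unfolding P.emeasure_eq_measure by (simp add: V_def B_def case_prod_beta)
qed

section \<open>Monopoly along a single path\<close>

lemma two_counters_loser_stops:
  fixes X Y :: "nat \<Rightarrow> nat"
  assumes step: "\<And>m. (X (Suc m) = Suc (X m) \<and> Y (Suc m) = Y m) \<or> (X (Suc m) = X m \<and> Y (Suc m) = Suc (Y m))"
    and win: "\<forall>m\<ge>M. X (Suc m) = Suc (X m)"
  shows "filterlim X at_top sequentially" "\<forall>\<^sub>F m in sequentially. Y m = Y M"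
proof -
  have X: "X m = X M + (m - M) \<and> Y m = Y M" if "m \<ge> M" for m
    using that
  proof (induction m rule: dec_induct)
    case (step m)
    then show ?case using win assms(1)[of m] by auto
  qed simp
  show "\<forall>\<^sub>F m in sequentially. Y m = Y M"
    using eventually_ge_at_top[of M] by eventually_elim (use X in blast)
  show "filterlim X at_top sequentially"
    unfolding filterlim_at_top
  proof
    fix K
    show "\<forall>\<^sub>F m in sequentially. K \<le> X m"
      using eventually_ge_at_top[of "M + K"]
    proof eventually_elim
      case (elim m)
      then show ?case using X[of m] by simp
    qed
  qed
qed

text \<open>A nondecreasing counter that does not diverge attains a maximum, after which every step
  must go to the other counter. Hence on paths without monopoly both loads diverge.\<close>

lemma two_counters_winner:
  fixes X Y :: "nat \<Rightarrow> nat"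
  assumes step: "\<And>m. (X (Suc m) = Suc (X m) \<and> Y (Suc m) = Y m) \<or> (X (Suc m) = X m \<and> Y (Suc m) = Suc (Y m))"
    and Y: "\<not> filterlim Y at_top sequentially"
  shows "\<exists>M. \<forall>m\<ge>M. X (Suc m) = Suc (X m)"
proof -
  have mono: "incseq Y"
    by (rule incseq_SucI) (use step in \<open>metis le_refl le_SucI\<close>)
  have "\<exists>K. \<forall>m. Y m < K"
  proof (rule ccontr)
    assume "\<nexists>K. \<forall>m. Y m < K"
    then have "\<forall>K. \<exists>m. K \<le> Y m" by (meson not_le)
    then have "filterlim Y at_top sequentially"
      unfolding filterlim_at_top eventually_sequentially by (meson mono incseqD order_trans)
    with Y show False ..
  qed
  then obtain M where M: "\<And>m. Y m \<le> Y M"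
    using ex_has_greatest_nat[of "\<lambda>_. True" 0 Y] by (meson less_imp_le)
  have "X (Suc m) = Suc (X m)" if "m \<ge> M" for m
    using M[of "Suc m"] incseqD[OF mono that] step[of m] by auto
  then show ?thesis by blast
qed

lemma AE_bins_process_path:
  "AE \<omega> in bins_process f u. \<omega> 0 = u \<and> (\<forall>m.
     (fst (\<omega> (Suc m)) = Suc (fst (\<omega> m)) \<and> snd (\<omega> (Suc m)) = snd (\<omega> m)) \<or>
     (fst (\<omega> (Suc m)) = fst (\<omega> m) \<and> snd (\<omega> (Suc m)) = Suc (snd (\<omega> m))))"
proof -
  have "AE \<omega> in bins_process f u. \<forall>m. \<omega> (Suc m)
      \<in> {(Suc (fst (\<omega> m)), snd (\<omega> m)), (fst (\<omega> m), Suc (snd (\<omega> m)))}"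
    unfolding AE_all_countable by (intro allI AE_bins_process_step)
  with AE_bins_process_0[of u f] show ?thesis
    by eventually_elim (auto simp: prod_eq_iff)
qed

text \<open>A shift of time by one removes the truncated subtraction \<open>m - 1\<close>, which is
  exact for \<open>m \<ge> 1\<close>.\<close>

lemma monopoly_1_iff: "monopoly 1 \<omega> \<longleftrightarrow> (\<exists>M. \<forall>m\<ge>M. fst (\<omega> (Suc m)) = Suc (fst (\<omega> m)))"
  and monopoly_2_iff: "monopoly 2 \<omega> \<longleftrightarrow> (\<exists>M. \<forall>m\<ge>M. snd (\<omega> (Suc m)) = Suc (snd (\<omega> m)))"
proof -
  have *: "(\<exists>M\<ge>1. \<forall>m\<ge>M. Z m = Z (m - 1) + 1) \<longleftrightarrow> (\<exists>M. \<forall>m\<ge>M. Z (Suc m) = Suc (Z m))"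
    for Z :: "nat \<Rightarrow> nat"
  proof
    assume "\<exists>M\<ge>1. \<forall>m\<ge>M. Z m = Z (m - 1) + 1"
    then obtain M where "\<And>m. m \<ge> M \<Longrightarrow> Z m = Z (m - 1) + 1" by blast
    from this[of "Suc m" for m] show "\<exists>M. \<forall>m\<ge>M. Z (Suc m) = Suc (Z m)"
      by (intro exI[of _ M]) auto
  next
    assume "\<exists>M. \<forall>m\<ge>M. Z (Suc m) = Suc (Z m)"
    then obtain M where M: "\<And>m. m \<ge> M \<Longrightarrow> Z (Suc m) = Suc (Z m)" by blast
    have "Z m = Z (m - 1) + 1" if "m \<ge> Suc M" for m
      using M[of "m - 1"] that by simp
    then show "\<exists>M\<ge>1. \<forall>m\<ge>M. Z m = Z (m - 1) + 1" by (intro exI[of _ "Suc M"]) auto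
  qed
  show "monopoly 1 \<omega> \<longleftrightarrow> (\<exists>M. \<forall>m\<ge>M. fst (\<omega> (Suc m)) = Suc (fst (\<omega> m)))"
    "monopoly 2 \<omega> \<longleftrightarrow> (\<exists>M. \<forall>m\<ge>M. snd (\<omega> (Suc m)) = Suc (snd (\<omega> m)))"
    unfolding monopoly_def using *[of "\<lambda>m. fst (\<omega> m)"] *[of "\<lambda>m. snd (\<omega> m)"]
    by (simp_all add: load_def)
qed

text \<open>The load of bin 2 is eventually constant, so the share of bin 1 tends to 1. This lets an
  upper bound for \<open>has_more_than\<close> rule out monopoly by bin 1.\<close>

lemma monopoly_1_imp_has_more_than:
  assumes path: "\<And>m. (fst (\<omega> (Suc m)) = Suc (fst (\<omega> m)) \<and> snd (\<omega> (Suc m)) = snd (\<omega> m)) \<or>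
      (fst (\<omega> (Suc m)) = fst (\<omega> m) \<and> snd (\<omega> (Suc m)) = Suc (snd (\<omega> m)))"
    and "monopoly 1 \<omega>" and "0 < \<beta>" "\<beta> < 1"
  shows "\<exists>N\<ge>n. has_more_than \<beta> N \<omega>"
proof -
  obtain M where M: "\<forall>m\<ge>M. fst (\<omega> (Suc m)) = Suc (fst (\<omega> m))"
    using assms(2) unfolding monopoly_1_iff by blast
  note lims = two_counters_loser_stops[of "\<lambda>m. fst (\<omega> m)" "\<lambda>m. snd (\<omega> m)" M, OF path M]
  \<comment> \<open>With loads \<open>x\<close> and \<open>y\<close>, the condition
    \<open>x > \<beta> * y / (1 - \<beta>)\<close> is \<open>x > \<beta> * (x + y)\<close>. The
    maximum with \<open>n\<close> makes the total large enough, and \<open>Suc\<close> makes the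
    inequality strict.\<close>
  define K where "K = max n (Suc (nat \<lceil>\<beta> * real (snd (\<omega> M)) / (1 - \<beta>)\<rceil>))"
  have "\<forall>\<^sub>F m in sequentially. K \<le> fst (\<omega> m)"
    using lims(1) unfolding filterlim_at_top by blast
  with lims(2) have "\<forall>\<^sub>F m in sequentially. K \<le> fst (\<omega> m) \<and> snd (\<omega> m) = snd (\<omega> M)"
    by eventually_elim auto
  then obtain m where m: "K \<le> fst (\<omega> m)" "snd (\<omega> m) = snd (\<omega> M)"
    by (auto simp: eventually_sequentially)
  have "\<beta> * real (snd (\<omega> M)) / (1 - \<beta>) < real (fst (\<omega> m))"
    using m(1) unfolding K_def by linarith
  then have "\<beta> * real (snd (\<omega> m)) < real (fst (\<omega> m)) * (1 - \<beta>)"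
    using assms(4) m(2) by (simp add: field_simps)
  then have "has_more_than \<beta> (fst (\<omega> m) + snd (\<omega> m)) \<omega>"
    unfolding has_more_than_def load_def by (intro exI[of _ m]) (simp add: algebra_simps)
  moreover have "fst (\<omega> m) + snd (\<omega> m) \<ge> n" using m(1) by (simp add: K_def)
  ultimately show ?thesis by blast
qed

section \<open>The complex martingale and almost sure monopoly\<close>

text \<open>\<open>\<rho> n\<close> is the inverse of the tail product of the factors \<open>1 + \<i> \<theta> / f j\<close> over \<open>j \<ge> n\<close>.\<close>

lemma normalised_products:
  fixes f :: "nat \<Rightarrow> real" and \<theta> :: real
  assumes pos: "\<And>n. n \<ge> 1 \<Longrightarrow> f n > 0" and sum: "summable (\<lambda>j. 1 / f (Suc j))"
  obtains \<rho> :: "nat \<Rightarrow> complex" where "\<And>n. n \<ge> 1 \<Longrightarrow> \<rho> (Suc n) = \<rho> n * Complex 1 (\<theta> / f n)"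
    "\<And>n. norm (\<rho> n) \<le> 1" "\<rho> \<longlonglongrightarrow> 1"
proof -
  define c where "c j = Complex 1 (\<theta> / f (Suc j))" for j
  have "norm (c j - 1) = \<bar>\<theta>\<bar> * (1 / f (Suc j))" for j
  proof -
    have "c j - 1 = \<i> * complex_of_real (\<theta> / f (Suc j))" by (simp add: c_def complex_eq_iff)
    then show ?thesis using pos[of "Suc j"] by (simp add: norm_mult norm_divide)
  qed
  with sum have "summable (\<lambda>j. norm (c j - 1))"
    by (simp add: summable_mult del: times_divide_eq_right)
  then have "convergent_prod c"
    by (intro abs_convergent_prod_imp_convergent_prod summable_imp_abs_convergent_prod)
  moreover have nz: "c j \<noteq> 0" for j by (simp add: c_def complex_eq_iff)
  ultimately obtain L where L: "(\<lambda>n. \<Prod>i\<le>n. c i) \<longlonglongrightarrow> L" "L \<noteq> 0"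
    by (auto simp: convergent_prod_iff_nz_lim)
  define P where "P n = (\<Prod>i<n. c i)" for n
  have P_lim: "P \<longlonglongrightarrow> L"
    using L(1) unfolding P_def by (subst filterlim_sequentially_Suc[symmetric]) (simp add: lessThan_Suc_atMost)
  \<comment> \<open>Every factor has real part 1, so the partial products grow in norm towards
    \<open>norm L\<close>. This is what bounds the normalised products by 1.\<close>
  have "norm (c j) \<ge> 1" for j
    by (simp add: c_def complex_norm)
  then have "incseq (\<lambda>n. norm (P n))"
    by (intro incseq_SucI) (simp add: P_def norm_mult mult_le_cancel_left1)
  then have le: "norm (P n) \<le> norm L" for n
    by (rule incseq_le) (rule tendsto_norm[OF P_lim])
  show ?thesis
  proof
    fix n :: nat
    \<comment> \<open>The witness is \<open>\<rho> n = P (n - 1) / L\<close>: since \<open>f\<close>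
      starts at 1, \<open>P (n - 1)\<close> collects the factors for \<open>j\<close> from 1 to
      \<open>n - 1\<close>.\<close>
    show "P (Suc n - 1) / L = P (n - 1) / L * Complex 1 (\<theta> / f n)" if "n \<ge> 1"
      using that by (cases n) (auto simp: P_def c_def)
    show "norm (P (n - 1) / L) \<le> 1"
      using le[of "n - 1"] L(2) by (simp add: norm_divide)
    have "(\<lambda>n. P (n - 1)) \<longlonglongrightarrow> L"
      by (subst filterlim_sequentially_Suc[symmetric]) (simp add: P_lim)
    then have "(\<lambda>n. P (n - 1) / L) \<longlonglongrightarrow> L / L"
      using L(2) by (intro tendsto_divide tendsto_const) auto
    then show "(\<lambda>n. P (n - 1) / L) \<longlonglongrightarrow> 1"
      using L(2) by simp
  qed
qed

lemma finite_set_bins_step: "finite (set_pmf (bins_step f s))"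
  by (rule finite_subset[OF set_bins_step]) simp

lemma finite_set_bins_marginal: "finite (set_pmf (bins_marginal f u m))"
  by (induction m arbitrary: u) (auto simp: finite_set_bins_step)

lemma expectation_bins_step:
  fixes Z :: "nat \<times> nat \<Rightarrow> complex"
  assumes "f (fst s) > 0" "f (snd s) > 0"
  shows "measure_pmf.expectation (bins_step f s) Z =
    (f (fst s) * Z (Suc (fst s), snd s) + f (snd s) * Z (fst s, Suc (snd s))) / (f (fst s) + f (snd s))"
proof -
  define p where "p = f (fst s) / (f (fst s) + f (snd s))"
  have p: "0 \<le> p" "p \<le> 1" "1 - p = f (snd s) / (f (fst s) + f (snd s))"
    using assms by (simp_all add: p_def field_simps)
  have "measure_pmf.expectation (bins_step f s) Z =
      p *\<^sub>R Z (Suc (fst s), snd s) + (1 - p) *\<^sub>R Z (fst s, Suc (snd s))"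
    using p(1,2) by (simp add: bins_step_def integral_measure_pmf[of UNIV] UNIV_bool flip: p_def)
  then show ?thesis
    unfolding p(3) by (simp add: p_def scaleR_conv_of_real add_divide_distrib)
qed

text \<open>Averaging a harmonic function over the first step changes nothing, and induction on time
  repeats this. Harmonicity is required only where both loads are at least 1, a region the chain
  never leaves.\<close>

lemma expectation_harmonic:
  fixes Z :: "nat \<times> nat \<Rightarrow> complex"
  assumes harm: "\<And>s. fst s \<ge> 1 \<Longrightarrow> snd s \<ge> 1 \<Longrightarrow> measure_pmf.expectation (bins_step f s) Z = Z s"
  shows "fst u \<ge> 1 \<Longrightarrow> snd u \<ge> 1 \<Longrightarrow> (\<integral>\<omega>. Z (\<omega> m) \<partial>bins_process f u) = Z u"
proof -
  have marg: "measure_pmf.expectation (bins_marginal f u m) Z = Z u" if "fst u \<ge> 1" "snd u \<ge> 1" for u m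
    using that
  proof (induction m arbitrary: u)
    case (Suc m)
    have "measure_pmf.expectation (bins_marginal f u (Suc m)) Z =
        (\<Sum>s\<in>set_pmf (bins_step f u). pmf (bins_step f u) s *\<^sub>R measure_pmf.expectation (bins_marginal f s m) Z)"
      by (simp add: pmf_expectation_bind[OF finite_set_bins_step finite_set_bins_marginal])
    also have "\<dots> = (\<Sum>s\<in>set_pmf (bins_step f u). pmf (bins_step f u) s *\<^sub>R Z s)"
      using Suc.prems set_bins_step[of f u] by (intro sum.cong refl arg_cong2[where f=scaleR] Suc.IH) auto
    also have "\<dots> = measure_pmf.expectation (bins_step f u) Z"
      by (subst integral_measure_pmf[OF finite_set_bins_step]) auto
    finally show ?case using harm Suc.prems by simp
  qed simp
  assume "fst u \<ge> 1" "snd u \<ge> 1"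
  moreover have "(\<integral>\<omega>. Z (\<omega> m) \<partial>bins_process f u) = measure_pmf.expectation (bins_marginal f u m) Z"
    unfolding distr_bins_process[symmetric] by (subst integral_distr) auto
  ultimately show ?thesis using marg by simp
qed

text \<open>The frequency \<theta> runs through the naturals \<open>k\<close>, so dominated
  convergence along sequences suffices, first in time \<open>m\<close> and then in
  \<open>k\<close>.\<close>

lemma monopoly_almost_sure:
  fixes f :: "nat \<Rightarrow> real"
  assumes pos: "\<And>n. n \<ge> 1 \<Longrightarrow> f n > 0" and sum: "summable (\<lambda>j. 1 / f (Suc j))"
    and ab: "a \<ge> 1" "b \<ge> 1"
  shows "AE \<omega> in bins_process f (a, b). monopoly 1 \<omega> \<or> monopoly 2 \<omega>"
proof -
  interpret P: prob_space "bins_process f (a, b)" by (rule prob_space_bins_process)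
  have "\<exists>\<rho> :: nat \<Rightarrow> complex. (\<forall>n\<ge>1. \<rho> (Suc n) = \<rho> n * Complex 1 (real k / f n)) \<and>
      (\<forall>n. norm (\<rho> n) \<le> 1) \<and> \<rho> \<longlonglongrightarrow> 1" for k :: nat
    using normalised_products[OF pos sum, of "real k"] by metis
  then obtain \<rho> :: "nat \<Rightarrow> nat \<Rightarrow> complex" where
    \<rho>_Suc: "\<And>k n. n \<ge> 1 \<Longrightarrow> \<rho> k (Suc n) = \<rho> k n * Complex 1 (real k / f n)"
    and \<rho>_le: "\<And>k n. norm (\<rho> k n) \<le> 1" and \<rho>_lim: "\<And>k. \<rho> k \<longlonglongrightarrow> 1"
    by metis
  \<comment> \<open>The value at \<open>Suc n\<close> is bounded by 1 and contains a factor of norm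
    at least \<open>k / f n\<close>, so the value at \<open>n\<close> is at most
    \<open>f n / k\<close>.\<close>
  have \<rho>_0: "(\<lambda>k. \<rho> k n) \<longlonglongrightarrow> 0" if n: "n \<ge> 1" for n
  proof (rule Lim_null_comparison)
    show "\<forall>\<^sub>F k in sequentially. norm (\<rho> k n) \<le> f n * inverse (real k)"
      using eventually_gt_at_top[of 0]
    proof eventually_elim
      case (elim k)
      have "real k / f n \<le> norm (Complex 1 (real k / f n))"
        using abs_Im_le_cmod[of "Complex 1 (real k / f n)"] pos[OF n] by simp
      then have "norm (\<rho> k n) * (real k / f n) \<le> norm (\<rho> k (Suc n))"
        unfolding \<rho>_Suc[OF n] norm_mult by (intro mult_left_mono) auto
      also have "\<dots> \<le> 1" by (rule \<rho>_le)
      finally show ?case using elim pos[OF n] by (simp add: field_simps)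
    qed
    show "(\<lambda>k. f n * inverse (real k)) \<longlonglongrightarrow> 0"
      by (intro tendsto_mult_right_zero lim_inverse_n)
  qed
  \<comment> \<open>Conjugation gives bin 2 the frequency \<open>-k\<close>. The weighted factors
    \<open>f x + \<i> * k\<close> and \<open>f y - \<i> * k\<close> then sum to
    \<open>f x + f y\<close>, which makes \<open>Z k\<close> harmonic.\<close>
  define Z where "Z k s = \<rho> k (fst s) * cnj (\<rho> k (snd s))" for k and s :: "nat \<times> nat"
  have Z_le: "norm (Z k s) \<le> 1" for k s
    using mult_mono[OF \<rho>_le \<rho>_le, of k "fst s" k "snd s"] by (simp add: Z_def norm_mult mult.commute)
  have harm: "measure_pmf.expectation (bins_step f s) (Z k) = Z k s" if "fst s \<ge> 1" "snd s \<ge> 1" for k s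
  proof -
    have fpos: "f (fst s) > 0" "f (snd s) > 0" using pos that by auto
    have F: "complex_of_real (f n) * Complex 1 (real k / f n) = f n + \<i> * k"
      "complex_of_real (f n) * cnj (Complex 1 (real k / f n)) = f n - \<i> * k" if "f n > 0" for n
      using that by (simp_all add: complex_eq_iff)
    have "complex_of_real (f (fst s)) * Z k (Suc (fst s), snd s) + f (snd s) * Z k (fst s, Suc (snd s))
       = \<rho> k (fst s) * cnj (\<rho> k (snd s)) * (f (fst s) * Complex 1 (real k / f (fst s)) +
          f (snd s) * cnj (Complex 1 (real k / f (snd s))))"
      unfolding Z_def using that by (simp add: \<rho>_Suc algebra_simps)
    also have "\<dots> = Z k s * (f (fst s) + f (snd s))"
      unfolding F[OF fpos(1)] F[OF fpos(2)] Z_def by (simp add: algebra_simps)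
    finally show ?thesis
      using fpos by (subst expectation_bins_step) (auto simp flip: of_real_add)
  qed
  define N where "N = {\<omega>. \<not> monopoly 1 \<omega> \<and> \<not> monopoly 2 \<omega>}"
  have N: "N \<in> sets (bins_process f (a, b))"
  proof -
    have "{\<omega> \<in> space (bins_process f (a, b)). \<not> monopoly 1 \<omega> \<and> \<not> monopoly 2 \<omega>} \<in> sets (bins_process f (a, b))"
      by measurable
    then show ?thesis by (simp add: N_def space_bins_process)
  qed
  \<comment> \<open>\<open>lim\<close> is measurable whether or not the sequence converges;
    \<open>lims\<close> shows that it is a genuine limit on almost every path.\<close>
  define W where "W k \<omega> = lim (\<lambda>m. Z k (\<omega> m))" for k \<omega>
  have Z_meas [measurable]: "(\<lambda>\<omega>. Z k (\<omega> m)) \<in> borel_measurable (bins_process f (a, b))" for k m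
    by (rule measurable_compose[OF measurable_bins_process]) simp
  have W_meas [measurable]: "W k \<in> borel_measurable (bins_process f (a, b))" for k
    unfolding W_def by (rule borel_measurable_lim_metric) (rule Z_meas)
  have lims: "AE \<omega> in bins_process f (a, b). (\<forall>k. (\<lambda>m. Z k (\<omega> m)) \<longlonglongrightarrow> W k \<omega>) \<and>
      (\<lambda>k. W k \<omega>) \<longlonglongrightarrow> indicator N \<omega>"
    using AE_bins_process_path
  proof eventually_elim
    case (elim \<omega>)
    let ?X = "\<lambda>m. fst (\<omega> m)" and ?Y = "\<lambda>m. snd (\<omega> m)"
    have path: "(?X (Suc m) = Suc (?X m) \<and> ?Y (Suc m) = ?Y m) \<or> (?X (Suc m) = ?X m \<and> ?Y (Suc m) = Suc (?Y m))"
      for m using elim by blast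
    have path': "(?Y (Suc m) = Suc (?Y m) \<and> ?X (Suc m) = ?X m) \<or> (?Y (Suc m) = ?Y m \<and> ?X (Suc m) = Suc (?X m))"
      for m using path by blast
    have ge1: "?X m \<ge> 1 \<and> ?Y m \<ge> 1" for m
    proof (induction m)
      case 0
      then show ?case using elim ab by simp
    next
      case (Suc m)
      then show ?case using path[of m] by auto
    qed
    have "\<exists>w. (\<forall>k. (\<lambda>m. Z k (\<omega> m)) \<longlonglongrightarrow> w k) \<and> w \<longlonglongrightarrow> indicator N \<omega>"
    proof -
      consider "monopoly 1 \<omega>" | "monopoly 2 \<omega>" | "\<omega> \<in> N" by (auto simp: N_def)
      then show ?thesis
      proof cases
        case 1
        then obtain M where M: "\<forall>m\<ge>M. ?X (Suc m) = Suc (?X m)"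
          unfolding monopoly_1_iff by blast
        note stop = two_counters_loser_stops[of ?X ?Y M, OF path M]
        \<comment> \<open>The winner's factor tends to 1, while the loser's is frozen at a load of
          at least 1, so \<open>\<rho>_0\<close> makes the limit vanish as \<open>k\<close>
          grows.\<close>
        have "(\<lambda>m. Z k (\<omega> m)) \<longlonglongrightarrow> 1 * cnj (\<rho> k (?Y M))" for k
          unfolding Z_def
          by (intro tendsto_mult filterlim_compose[OF \<rho>_lim stop(1)] tendsto_eventually
              eventually_mono[OF stop(2)]) simp
        moreover have "(\<lambda>k. 1 * cnj (\<rho> k (?Y M))) \<longlonglongrightarrow> 1 * cnj 0"
          using ge1 by (intro tendsto_intros \<rho>_0) auto
        moreover have "indicator N \<omega> = (0 :: complex)" using 1 by (simp add: N_def)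
        ultimately show ?thesis by (intro exI[of _ "\<lambda>k. 1 * cnj (\<rho> k (?Y M))"]) auto
      next
        case 2
        then obtain M where M: "\<forall>m\<ge>M. ?Y (Suc m) = Suc (?Y m)"
          unfolding monopoly_2_iff by blast
        note stop = two_counters_loser_stops[of ?Y ?X M, OF path' M]
        have "(\<lambda>m. Z k (\<omega> m)) \<longlonglongrightarrow> \<rho> k (?X M) * cnj 1" for k
          unfolding Z_def
          by (intro tendsto_mult tendsto_cnj filterlim_compose[OF \<rho>_lim stop(1)] tendsto_eventually
              eventually_mono[OF stop(2)]) simp
        moreover have "(\<lambda>k. \<rho> k (?X M) * cnj 1) \<longlonglongrightarrow> 0 * cnj 1"
          using ge1 by (intro tendsto_intros \<rho>_0) auto
        moreover have "indicator N \<omega> = (0 :: complex)" using 2 by (simp add: N_def)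
        ultimately show ?thesis by (intro exI[of _ "\<lambda>k. \<rho> k (?X M) * cnj 1"]) auto
      next
        case 3
        have X: "filterlim ?X at_top sequentially"
          using two_counters_winner[of ?Y ?X, OF path'] 3 unfolding N_def monopoly_2_iff by blast
        have Y: "filterlim ?Y at_top sequentially"
          using two_counters_winner[of ?X ?Y, OF path] 3 unfolding N_def monopoly_1_iff by blast
        have "(\<lambda>m. Z k (\<omega> m)) \<longlonglongrightarrow> 1 * cnj 1" for k
          unfolding Z_def
          by (intro tendsto_mult tendsto_cnj filterlim_compose[OF \<rho>_lim X] filterlim_compose[OF \<rho>_lim Y])
        moreover have "indicator N \<omega> = (1 :: complex)" using 3 by simp
        ultimately show ?thesis by (intro exI[of _ "\<lambda>k. 1"]) auto
      qed
    qed
    then obtain w where w: "\<And>k. (\<lambda>m. Z k (\<omega> m)) \<longlonglongrightarrow> w k" "w \<longlonglongrightarrow> indicator N \<omega>" by blast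
    then have "W k \<omega> = w k" for k unfolding W_def by (intro limI)
    with w show ?case by simp
  qed
  \<comment> \<open>The uniform bound 1 on \<open>Z k\<close> carries the martingale identity
    through the limit in time.\<close>
  have W_int: "(\<integral>\<omega>. W k \<omega> \<partial>bins_process f (a, b)) = Z k (a, b)" for k
  proof -
    have "(\<lambda>m. \<integral>\<omega>. Z k (\<omega> m) \<partial>bins_process f (a, b)) \<longlonglongrightarrow> (\<integral>\<omega>. W k \<omega> \<partial>bins_process f (a, b))"
    proof (rule integral_dominated_convergence[where w = "\<lambda>_. 1"])
      show "AE \<omega> in bins_process f (a, b). (\<lambda>m. Z k (\<omega> m)) \<longlonglongrightarrow> W k \<omega>"
        using lims by eventually_elim blast
    qed (use Z_le in auto)
    moreover have "(\<integral>\<omega>. Z k (\<omega> m) \<partial>bins_process f (a, b)) = Z k (a, b)" for m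
      using ab by (intro expectation_harmonic harm) auto
    ultimately show ?thesis by (simp add: LIMSEQ_const_iff)
  qed
  \<comment> \<open>The limit over \<open>k\<close> turns these expectations into the probability of
    \<open>N\<close>, while their values \<open>Z k (a, b)\<close> tend to 0.\<close>
  have "(\<lambda>k. \<integral>\<omega>. W k \<omega> \<partial>bins_process f (a, b)) \<longlonglongrightarrow> (\<integral>\<omega>. indicator N \<omega> \<partial>bins_process f (a, b) :: complex)"
  proof (rule integral_dominated_convergence[where w = "\<lambda>_. 1"])
    show "AE \<omega> in bins_process f (a, b). (\<lambda>k. W k \<omega>) \<longlonglongrightarrow> indicator N \<omega>"
      using lims by eventually_elim blast
    show "AE \<omega> in bins_process f (a, b). norm (W k \<omega>) \<le> 1" for k
      using lims
    proof eventually_elim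
      case (elim \<omega>)
      then have "(\<lambda>m. norm (Z k (\<omega> m))) \<longlonglongrightarrow> norm (W k \<omega>)" by (intro tendsto_norm) blast
      then show ?case by (rule LIMSEQ_le_const2) (use Z_le in auto)
    qed
  qed (use N in auto)
  moreover have "(\<lambda>k. Z k (a, b)) \<longlonglongrightarrow> 0"
  proof (rule Lim_null_comparison)
    show "\<forall>\<^sub>F k in sequentially. norm (Z k (a, b)) \<le> norm (\<rho> k a)"
      using \<rho>_le by (intro always_eventually) (auto simp: Z_def norm_mult mult_left_le)
    show "(\<lambda>k. norm (\<rho> k a)) \<longlonglongrightarrow> 0"
      using \<rho>_0[OF ab(1)] by (rule tendsto_norm_zero)
  qed
  ultimately have "(\<integral>\<omega>. indicator N \<omega> \<partial>bins_process f (a, b) :: complex) = 0"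
    unfolding W_int by (rule LIMSEQ_unique)
  moreover have "(\<integral>\<omega>. indicator N \<omega> \<partial>bins_process f (a, b) :: complex) = P.prob N"
  proof -
    have "(indicator N :: _ \<Rightarrow> complex) = (\<lambda>\<omega>. complex_of_real (indicator N \<omega>))"
      by (simp add: fun_eq_iff indicator_def)
    then show ?thesis using N by simp
  qed
  ultimately have "P.prob N = 0" by simp
  then have "AE \<omega> in bins_process f (a, b). \<omega> \<notin> N"
    using N by (simp add: P.prob_eq_0)
  then show ?thesis by eventually_elim (auto simp: N_def)
qed

section \<open>Choice of constants and conclusion for both events\<close>

theorem theorem3:
  fixes f :: "nat \<Rightarrow> real"
  assumes "valid_feedback f"
  shows "summable (\<lambda>j. 1 / f (Suc j)) \<and>
    (\<forall>a\<ge>1. \<forall>b\<ge>1. measure (bins_process f (a, b)) {\<omega>. monopoly 1 \<omega> \<or> monopoly 2 \<omega>} = 1) \<and>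
    (\<forall>\<alpha> \<beta>. 0 < \<alpha> \<and> \<alpha> < \<beta> \<and> \<beta> < 1/2 \<longrightarrow>
      (\<exists>\<gamma>>0.
        (\<forall>\<^sub>F n in sequentially.
           measure (bins_process f (initial_state n \<alpha>)) {\<omega>. \<exists>N\<ge>n. has_more_than \<beta> N \<omega>}
             \<le> exp (- (real n powr \<gamma>))) \<and>
        (\<forall>\<^sub>F n in sequentially.
           measure (bins_process f (initial_state n \<alpha>)) {\<omega>. monopoly 2 \<omega>}
             \<ge> 1 - exp (- (real n powr \<gamma>)))))"
proof (intro conjI allI impI)
  note pos = valid_feedback_pos[OF assms]
  note sum = valid_feedback_summable[OF assms]
  show "summable (\<lambda>j. 1 / f (Suc j))" by (rule sum)
  have mono_AE: "AE \<omega> in bins_process f (a, b). monopoly 1 \<omega> \<or> monopoly 2 \<omega>" if "a \<ge> 1" "b \<ge> 1" for a b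
    by (rule monopoly_almost_sure) (use pos sum that in auto)
  have monopoly_sets: "{\<omega>. monopoly i \<omega>} \<in> sets (bins_process f u)" for i u
    using pred_monopoly[where f = f and u = u and i = i] by (simp add: pred_def space_bins_process)
  show "measure (bins_process f (a, b)) {\<omega>. monopoly 1 \<omega> \<or> monopoly 2 \<omega>} = 1"
    if "a \<ge> 1" "b \<ge> 1" for a b
  proof -
    interpret P: prob_space "bins_process f (a, b)" by (rule prob_space_bins_process)
    show ?thesis
      using mono_AE[OF that] sets.Un[OF monopoly_sets[of 1] monopoly_sets[of 2]]
      by (subst P.prob_eq_1) (auto simp: Un_def)
  qed
  fix \<alpha> \<beta> :: real
  assume ab: "0 < \<alpha> \<and> \<alpha> < \<beta> \<and> \<beta> < 1 / 2"
  obtain c x0 where c: "c > 1" "x0 \<ge> 1"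
    and growth: "\<And>m n. x0 \<le> m \<Longrightarrow> m \<le> n \<Longrightarrow> f m * (real n / real m) powr c \<le> f n"
    using valid_feedback_growth[OF assms] by blast
  have linear_growth: "f m * (real n / real m) \<le> f n" if "x0 \<le> m" "m \<le> n" for m n
  proof -
    have "real n / real m \<ge> 1" using that c by simp
    then have "real n / real m \<le> (real n / real m) powr c"
      using powr_mono[of 1 c "real n / real m"] c by simp
    then have "f m * (real n / real m) \<le> f m * (real n / real m) powr c"
      using pos[of m] that c by (intro mult_left_mono) auto
    also have "\<dots> \<le> f n" by (rule growth[OF that])
    finally show ?thesis .
  qed
  define d where "d = \<beta> - \<alpha>"
  have d: "d > 0" using ab by (simp add: d_def)
  have ev_large: "\<forall>\<^sub>F n in sequentially. real n \<ge> K" for K :: real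
    using eventually_ge_at_top[of "nat \<lceil>K\<rceil>"] by eventually_elim linarith
  \<comment> \<open>The left side is the optimised exponent, with \<open>4 * d\<close> paying for
    the rounding of \<open>\<alpha> * n\<close>. Being linear in \<open>n\<close>, it eventually
    drops below \<open>- (n powr \<gamma>)\<close> for any \<gamma> < 1; here \<gamma> is
    1/2.\<close>
  have bound_ev: "\<forall>\<^sub>F n in sequentially. - 2 * d\<^sup>2 * real n + 4 * d \<le> - (real n powr (1/2))"
    using d by real_asymp
  have main: "\<forall>\<^sub>F n in sequentially.
      measure (bins_process f (initial_state n \<alpha>)) {\<omega>. \<exists>N\<ge>n. has_more_than \<beta> N \<omega>} \<le> exp (- (real n powr (1/2)))
    \<and> measure (bins_process f (initial_state n \<alpha>)) {\<omega>. monopoly 2 \<omega>} \<ge> 1 - exp (- (real n powr (1/2)))"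
    \<comment> \<open>The second condition starts bin 1 with at least \<open>x0\<close> balls; the
      third leaves room for the ceiling, so that bin 2 starts nonempty.\<close>
    using bound_ev ev_large[of "real x0 / \<alpha>"] ev_large[of 4]
  proof eventually_elim
    case (elim n)
    define a where "a = nat \<lceil>\<alpha> * real n\<rceil>"
    define b where "b = n - a"
    have "\<alpha> * real n \<le> 1 / 2 * real n" using ab by (intro mult_right_mono) auto
    then have "a < n" using elim(3) unfolding a_def by linarith
    then have n: "a + b = n" "b \<ge> 1" by (simp_all add: b_def)
    have "real x0 \<le> \<alpha> * real n" using elim(2) ab by (simp add: field_simps)
    then have a: "a \<ge> x0" unfolding a_def by linarith
    have "0 \<le> \<alpha> * real n" using ab by simp
    then have a_le: "real a \<le> \<alpha> * real n + 1" unfolding a_def by linarith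
    have init: "initial_state n \<alpha> = (a, b)" by (simp add: initial_state_def a_def b_def)
    interpret P: prob_space "bins_process f (a, b)" by (rule prob_space_bins_process)
    let ?H = "{\<omega>. \<exists>N\<ge>n. has_more_than \<beta> N \<omega>}"
    have H: "?H \<in> P.events"
    proof -
      have "{\<omega> \<in> space (bins_process f (a, b)). \<exists>N\<ge>n. has_more_than \<beta> N \<omega>} \<in> P.events" by measurable
      then show ?thesis by (simp add: space_bins_process)
    qed
    define l where "l = 4 * real n * d" \<comment> \<open>minimises \<open>- l * d + l\<^sup>2 / (8 * n)\<close>\<close>
    have l: "l \<ge> 0" using d by (simp add: l_def)
    let ?E = "{\<omega>. \<exists>m. real (fst (\<omega> m)) > \<beta> * real (fst (\<omega> m) + snd (\<omega> m))}"
    have E: "?E \<in> P.events"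
    proof -
      have "{\<omega> \<in> space (bins_process f (a, b)). \<exists>m. \<omega> m \<in> {s. real (fst s) > \<beta> * real (fst s + snd s)}} \<in> P.events"
        by measurable
      then show ?thesis by (simp add: space_bins_process)
    qed
    \<comment> \<open>The larger event \<open>?E\<close> drops the restriction to totals
      \<open>N \<ge> n\<close> and speaks of states only, as \<open>ratio_hitting_bound\<close>
      requires.\<close>
    have "P.prob ?H \<le> P.prob ?E"
      using E by (intro P.finite_measure_mono) (auto simp: has_more_than_def load_def)
    also have "\<dots> \<le> exp (l * (real a / real (a + b) - \<beta>) + l\<^sup>2 / (8 * real (a + b)))"
      by (rule ratio_hitting_bound[OF _ _ c(2) a n(2)]) (use pos linear_growth ab l in auto)
    also have "\<dots> \<le> exp (- 2 * d\<^sup>2 * real n + 4 * d)"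
    proof (subst exp_le_cancel_iff)
      have n0: "real n > 0" using elim(3) by simp
      have "real a / real n \<le> \<alpha> + 1 / real n"
        using a_le n0 by (simp add: field_simps)
      then have "l * (real a / real n - \<beta>) \<le> l * (1 / real n - d)"
        using l by (intro mult_left_mono) (auto simp: d_def)
      moreover have "l * (1 / real n - d) + l\<^sup>2 / (8 * real n) = - 2 * d\<^sup>2 * real n + 4 * d"
        using n0 by (simp add: l_def field_simps power2_eq_square)
      ultimately show "l * (real a / real (a + b) - \<beta>) + l\<^sup>2 / (8 * real (a + b)) \<le> - 2 * d\<^sup>2 * real n + 4 * d"
        unfolding n(1) by linarith
    qed
    also have "\<dots> \<le> exp (- (real n powr (1/2)))" using elim(1) by simp
    finally have 1: "P.prob ?H \<le> exp (- (real n powr (1/2)))" .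
    have ge1: "a \<ge> 1" "b \<ge> 1" using a c(2) n(2) by auto
    \<comment> \<open>Monopoly by bin 1 would push its share past \<beta> at some total of at least
      \<open>n\<close>, so almost every path outside \<open>?H\<close> is won by bin 2.\<close>
    have "AE \<omega> in bins_process f (a, b). \<omega> \<in> {\<omega>. monopoly 2 \<omega>} \<union> ?H"
      using mono_AE[OF ge1] AE_bins_process_path
    proof eventually_elim
      fix \<omega> assume "monopoly 1 \<omega> \<or> monopoly 2 \<omega>"
        and path: "\<omega> 0 = (a, b) \<and> (\<forall>m.
          (fst (\<omega> (Suc m)) = Suc (fst (\<omega> m)) \<and> snd (\<omega> (Suc m)) = snd (\<omega> m)) \<or>
          (fst (\<omega> (Suc m)) = fst (\<omega> m) \<and> snd (\<omega> (Suc m)) = Suc (snd (\<omega> m))))"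
      then show "\<omega> \<in> {\<omega>. monopoly 2 \<omega>} \<union> ?H"
        using monopoly_1_imp_has_more_than[of \<omega> \<beta> n] ab by auto
    qed
    then have "1 = P.prob ({\<omega>. monopoly 2 \<omega>} \<union> ?H)"
      unfolding P.prob_eq_1[OF sets.Un[OF monopoly_sets[of 2] H], symmetric] ..
    also have "\<dots> \<le> P.prob {\<omega>. monopoly 2 \<omega>} + P.prob ?H"
      by (rule measure_subadditive[OF monopoly_sets H]) auto
    finally show ?case using 1 unfolding init by linarith
  qed
  show "\<exists>\<gamma>>0.
        (\<forall>\<^sub>F n in sequentially.
           measure (bins_process f (initial_state n \<alpha>)) {\<omega>. \<exists>N\<ge>n. has_more_than \<beta> N \<omega>}
             \<le> exp (- (real n powr \<gamma>))) \<and>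
        (\<forall>\<^sub>F n in sequentially.
           measure (bins_process f (initial_state n \<alpha>)) {\<omega>. monopoly 2 \<omega>}
             \<ge> 1 - exp (- (real n powr \<gamma>)))"
    using main by (intro exI[of _ "1/2"]) (auto simp: eventually_conj_iff)
qed

end
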